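(* For every real $x$ with $0<|x|<1$, $$\int_0^\pi \frac{\theta \sin^5 \theta}{1-x^2\cos^2 \theta}\,d\theta=\frac{\pi}{x^4}\left[\frac53 x^2-1+\frac{(x^2-1)^2}{x}\tanh^{-1} x\right].$$
   Context: $\tanh^{-1}x=\frac12\ln\frac{1+x}{1-x}$ for $|x|<1$. *)

theory Defs
  imports "HOL-Analysis.Analysis"
begin

end

theory Submission
  imports Defs
begin

text \<open>Reflecting \<open>\<theta> \<mapsto> \<pi> - \<theta>\<close> replaces the factor \<open>\<theta>\<close> by \<open>\<pi> / 2\<close>. The substitution
  \<open>u = cos \<theta>\<close> then leaves the rational integral of \<open>(1 - u\<^sup>2)\<^sup>2 / (1 - x\<^sup>2 u\<^sup>2)\<close> over \<open>[-1, 1]\<close>,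
  which polynomial division in \<open>u\<^sup>2\<close> evaluates.\<close>

lemma has_integral_reflect_interval:
  fixes f :: "real \<Rightarrow> 'a::real_normed_vector"
  assumes "(f has_integral I) {0..a}"
  shows "((\<lambda>t. f (a - t)) has_integral I) {0..a}"
proof -
  have "((\<lambda>t. f (- 1 *\<^sub>R t + a)) has_integral I) ((\<lambda>t. a - t) ` {0..a})"
    using has_integral_affinity[of f I 0 a "-1" a] assms by simp
  moreover have "(\<lambda>t. a - t) ` {0..a} = {0..a}"
    by simp
  ultimately show ?thesis
    by simp
qed

text \<open>Adding the integral to its reflected copy turns the weight into
  \<open>t + (a - t) = a\<close>, so twice the unknown value is \<open>a * J\<close>.\<close>

lemma has_integral_mult_reflection_symmetric:
  fixes g :: "real \<Rightarrow> real"
  assumes cont: "continuous_on {0..a} g"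
    and sym: "\<And>t. g (a - t) = g t"
    and int: "(g has_integral J) {0..a}"
  shows "((\<lambda>t. t * g t) has_integral (a / 2 * J)) {0..a}"
proof -
  \<comment> \<open>Continuity gives existence first, so that the value can be named
    \<open>I\<close> and solved for.\<close>
  have "(\<lambda>t. t * g t) integrable_on {0..a}"
    by (intro integrable_continuous_real continuous_intros cont)
  then obtain I where I: "((\<lambda>t. t * g t) has_integral I) {0..a}"
    by blast
  have "((\<lambda>t. t * g t + (a - t) * g (a - t)) has_integral I + I) {0..a}"
    by (intro has_integral_add I has_integral_reflect_interval[OF I])
  then have "((\<lambda>t. a * g t) has_integral I + I) {0..a}"
    by (simp add: sym algebra_simps)
  moreover have "((\<lambda>t. a * g t) has_integral a * J) {0..a}"
    using has_integral_mult_right[OF int] .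
  ultimately have "I + I = a * J"
    by (rule has_integral_unique)
  then have "I = a / 2 * J"
    by simp
  with I show ?thesis by simp
qed

text \<open>The first bound keeps \<open>x * cos t\<close> where \<open>artanh\<close> is
  differentiable; the second keeps the denominator away from zero.\<close>

lemma one_minus_square_mult_cos_square_pos:
  fixes x :: real
  assumes "\<bar>x\<bar> < 1"
  shows "\<bar>x * cos t\<bar> < 1" and "1 - x\<^sup>2 * (cos t)\<^sup>2 > 0"
proof -
  show *: "\<bar>x * cos t\<bar> < 1"
    using assms mult_left_mono[OF abs_cos_le_one[of t] abs_ge_zero[of x]]
    by (simp add: abs_mult)
  show "1 - x\<^sup>2 * (cos t)\<^sup>2 > 0"
    using * abs_square_less_1[of "x * cos t"] by (simp add: power_mult_distrib)
qed

lemma has_integral_sin5_over: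
  fixes x :: real
  assumes "x \<noteq> 0" and "\<bar>x\<bar> < 1"
  shows "((\<lambda>\<theta>. sin \<theta> ^ 5 / (1 - x\<^sup>2 * (cos \<theta>)\<^sup>2)) has_integral
           2 / x ^ 4 * (5 / 3 * x\<^sup>2 - 1 + (x\<^sup>2 - 1)\<^sup>2 / x * artanh x)) {0..pi}"
proof -
  \<comment> \<open>Dividing \<open>x ^ 4 * (1 - u\<^sup>2)\<^sup>2\<close> by
    \<open>1 - x\<^sup>2 * u\<^sup>2\<close> leaves quotient
    \<open>2 * x\<^sup>2 - 1 - x\<^sup>2 * u\<^sup>2\<close> and remainder
    \<open>(x\<^sup>2 - 1)\<^sup>2\<close>. The quotient integrates to the polynomial part of
    \<open>G\<close>, the remainder to the \<open>artanh\<close> term.\<close>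
  define G where "G u = (- (x\<^sup>2 * u ^ 3 / 3) + (2 * x\<^sup>2 - 1) * u
      + (x\<^sup>2 - 1)\<^sup>2 / x * artanh (x * u)) / x ^ 4" for u
  note xcos = one_minus_square_mult_cos_square_pos[OF assms(2)]
  have dG: "(G has_real_derivative (1 - u\<^sup>2)\<^sup>2 / (1 - x\<^sup>2 * u\<^sup>2)) (at u)"
    if u: "\<bar>x * u\<bar> < 1" "1 - x\<^sup>2 * u\<^sup>2 > 0" for u
  proof -
    have "((\<lambda>u. artanh (x * u)) has_real_derivative x / (1 - x\<^sup>2 * u\<^sup>2)) (at u)"
      using DERIV_chain2[OF artanh_real_has_field_derivative[OF u(1)] DERIV_cmult_Id]
      by (simp add: power_mult_distrib)
    then have "(G has_real_derivative (- (x\<^sup>2 * (3 * u\<^sup>2) / 3) + (2 * x\<^sup>2 - 1) * 1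
        + (x\<^sup>2 - 1)\<^sup>2 / x * (x / (1 - x\<^sup>2 * u\<^sup>2))) / x ^ 4) (at u)"
      unfolding G_def
      by (intro DERIV_cdivide DERIV_add DERIV_minus DERIV_cmult DERIV_ident)
         (auto intro!: derivative_eq_intros)
    moreover have "(- (x\<^sup>2 * (3 * u\<^sup>2) / 3) + (2 * x\<^sup>2 - 1) * 1
        + (x\<^sup>2 - 1)\<^sup>2 / x * (x / (1 - x\<^sup>2 * u\<^sup>2))) / x ^ 4 = (1 - u\<^sup>2)\<^sup>2 / (1 - x\<^sup>2 * u\<^sup>2)"
    proof -
      define d where "d = 1 - x\<^sup>2 * u\<^sup>2"
      \<comment> \<open>This is the division with remainder behind \<open>G\<close>, solved for the
        remainder.\<close>
      have "(x\<^sup>2 - 1)\<^sup>2 = x ^ 4 * (1 - u\<^sup>2)\<^sup>2 - (2 * x\<^sup>2 - 1 - x\<^sup>2 * u\<^sup>2) * d"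
        unfolding d_def by algebra
      moreover have "d \<noteq> 0"
        using u(2) by (simp add: d_def)
      ultimately have "(x\<^sup>2 - 1)\<^sup>2 / d = x ^ 4 * (1 - u\<^sup>2)\<^sup>2 / d - (2 * x\<^sup>2 - 1 - x\<^sup>2 * u\<^sup>2)"
        by (simp add: diff_divide_distrib)
      then show ?thesis
        using assms(1) unfolding d_def[symmetric] by simp
    qed
    ultimately show ?thesis
      by simp
  qed
  \<comment> \<open>The minus sign cancels the one from the derivative of \<open>cos\<close>, and
    \<open>(1 - (cos t)\<^sup>2)\<^sup>2 * sin t\<close> is \<open>sin t ^ 5\<close>.\<close>
  have deriv: "((\<lambda>t. - G (cos t)) has_real_derivative
      sin t ^ 5 / (1 - x\<^sup>2 * (cos t)\<^sup>2)) (at t within {0..pi})" for t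
  proof -
    have "((\<lambda>t. - G (cos t)) has_real_derivative
        - ((1 - (cos t)\<^sup>2)\<^sup>2 / (1 - x\<^sup>2 * (cos t)\<^sup>2) * (- sin t))) (at t)"
      by (intro DERIV_minus DERIV_chain2[OF dG] DERIV_cos xcos)
    also have "- ((1 - (cos t)\<^sup>2)\<^sup>2 / (1 - x\<^sup>2 * (cos t)\<^sup>2) * (- sin t))
        = sin t ^ 5 / (1 - x\<^sup>2 * (cos t)\<^sup>2)"
      unfolding sin_squared_eq[symmetric] by (simp add: eval_nat_numeral)
    finally show ?thesis
      by (rule has_field_derivative_at_within)
  qed
  have "((\<lambda>\<theta>. sin \<theta> ^ 5 / (1 - x\<^sup>2 * (cos \<theta>)\<^sup>2)) has_integral
      - G (cos pi) - (- G (cos 0))) {0..pi}"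
    by (intro fundamental_theorem_of_calculus
        deriv[unfolded has_real_derivative_iff_has_vector_derivative]) simp
  moreover have "- G (cos pi) - (- G (cos 0))
      = 2 / x ^ 4 * (5 / 3 * x\<^sup>2 - 1 + (x\<^sup>2 - 1)\<^sup>2 / x * artanh x)"
  proof -
    \<comment> \<open>\<open>G\<close> is odd, so the boundary terms add up to
      \<open>2 * G 1\<close>; there \<open>- x\<^sup>2 / 3 + 2 * x\<^sup>2\<close> gives the
      coefficient 5/3.\<close>
    have "G (- 1) = - G 1"
      using assms(2) by (simp add: G_def artanh_minus_real diff_divide_distrib add_divide_distrib)
    moreover have "2 * G 1 = 2 / x ^ 4 * (5 / 3 * x\<^sup>2 - 1 + (x\<^sup>2 - 1)\<^sup>2 / x * artanh x)"
      by (simp add: G_def)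
    ultimately show ?thesis
      by simp
  qed
  ultimately show ?thesis
    by simp
qed

theorem mainTheorem4:
  fixes x :: real
  assumes "0 < \<bar>x\<bar>" and "\<bar>x\<bar> < 1"
  shows "((\<lambda>\<theta>::real. \<theta> * sin \<theta> ^ 5 / (1 - x\<^sup>2 * (cos \<theta>)\<^sup>2)) has_integral
           (pi / x ^ 4 * (5 / 3 * x\<^sup>2 - 1 + (x\<^sup>2 - 1)\<^sup>2 / x * artanh x))) {0..pi}"
proof -
  let ?g = "\<lambda>\<theta>. sin \<theta> ^ 5 / (1 - x\<^sup>2 * (cos \<theta>)\<^sup>2)"
  \<comment> \<open>Stated for arbitrary \<open>c\<close> so that the long bracket stays untouched
    when the factors 2 cancel.\<close>
  have half: "pi / 2 * (2 / x ^ 4 * c) = pi / x ^ 4 * c" for c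
    by simp
  have "1 - x\<^sup>2 * (cos t)\<^sup>2 \<noteq> 0" for t
    using one_minus_square_mult_cos_square_pos(2)[OF assms(2), of t] by simp
  then have "continuous_on {0..pi} ?g"
    by (intro continuous_intros) auto
  moreover have "?g (pi - t) = ?g t" for t
    by simp
  ultimately have "((\<lambda>\<theta>. \<theta> * ?g \<theta>) has_integral
      pi / 2 * (2 / x ^ 4 * (5 / 3 * x\<^sup>2 - 1 + (x\<^sup>2 - 1)\<^sup>2 / x * artanh x))) {0..pi}"
    using assms by (intro has_integral_mult_reflection_symmetric has_integral_sin5_over) auto
  then show ?thesis
    unfolding half by (simp only: times_divide_eq_right)
qed

end
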